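(* Let $\mathcal M$ be a category of $R$-modules, and let $\mathcal C$ be a pre-enveloping subclass. Let $\mathcal P'$ be a class of pairs $(L,M)$ such that $L,M\in\mathcal M$, $L\subseteq M$, and the inclusion map $L\hookrightarrow M$ is in $\mathcal M$. Assume that whenever $\phi:M\to N$ is a morphism in $\mathcal M$ and $(L,M)\in\mathcal P'$, then $(\phi(L),N)\in\mathcal P'$. Let $p$ be a functorial pair operation defined on $\mathcal P=\mathcal P'|_{\mathcal C}:=\{(L,C)\in\mathcal P'\mid C\in\mathcal C\}$. Define the pair operation $p_{h(\mathcal C)}$ on $\mathcal P'$ so that, when $\alpha:M\to C$ is a $\mathcal C$-preenvelope, $p_{h(\mathcal C)}(L,M)=\alpha^{-1}(p(\alpha(L),C))$. Then $p_{h(\mathcal C)}$ is well-defined and functorial. Moreover: (1) If $p$ is order-preserving on submodules, then so is $p_{h(\mathcal C)}$. (2) If $p$ is extensive, then so is $p_{h(\mathcal C)}$. (3) If $p$ is a closure operation, then $p_{h(\mathcal C)}$ is also idempotent. (4) Let $(L,M)\in\mathcal P'$ and $x\in M$. Then $x\in p_{h(\mathcal C)}(L,M)$ if and only if for every map $g:M\to C$ in $\mathcal M$ with $C\in\mathcal C$, we have $g(x)\in p(g(L),C)$. Hence, if $p$ is a closure operation, then so is $p_{h(\mathcal C)}$.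
   Context: $R$ is a commutative ring; $\mathcal M$ is a category of $R$-modules and $R$-linear maps. A class $\mathcal C$ of modules in $\mathcal M$ is pre-enveloping (for $\mathcal M$) if for every $M\in\mathcal M$ there are $C\in\mathcal C$ and a morphism $\alpha:M\to C$ in $\mathcal M$ such that every morphism $g:M\to D$ in $\mathcal M$ with $D\in\mathcal C$ factors as $g=\tilde g\circ\alpha$ for some morphism $\tilde g:C\to D$ in $\mathcal M$; such an $\alpha$ is called a $\mathcal C$-preenvelope of $M$. A pair operation on a class of pairs is a function $p$ sending each $(L,M)$ in the class to a submodule $p(L,M)$ of $M$, such that $\phi(p(L,M))=p(\phi(L),M')$ for every isomorphism $\phi:M\to M'$ in $\mathcal M$. It is: extensive if $L\subseteq p(L,M)$ always; order-preserving on submodules if $p(L,M)\subseteq p(N,M)$ whenever $L\subseteq N\subseteq M$ and both pairs are in the class; idempotent if $p(p(L,M),M)=p(L,M)$ whenever $(L,M)$ and $(p(L,M),M)$ are in the class; a closure operation if it is extensive, order-preserving on submodules and idempotent; functorial if $g(p(L,M))\subseteq p(g(L),M')$ whenever $g:M\to M'$ is in $\mathcal M$ and $(L,M),(g(L),M')$ are in the class.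
   Formalization: Part (3) and the final "Hence" additionally assume that (p(L,C),C) is in P whenever (L,C) is in P; without this, idempotence of p can hold vacuously and does not pass to p_{h(C)}. *)

theory Defs
  imports "HOL-Algebra.Module" "HOL-Library.FuncSet"
begin

text \<open>
  Linear maps are extensional functions (undefined outside the carrier of their domain), so
  equality of functions is equality of morphisms, and morphisms are composed with
  \<^const>\<open>compose\<close>.  A submodule is given by its carrier set; as a module in its own right,
  the submodule \<open>L\<close> of \<open>M\<close> is \<open>M\<lparr>carrier := L\<rparr>\<close>.
\<close>

definition linear_maps ::
  "('a, 'r) ring_scheme \<Rightarrow> ('a, 'b) module \<Rightarrow> ('a, 'b) module \<Rightarrow> ('b \<Rightarrow> 'b) set" where
  "linear_maps R M N = {f \<in> carrier M \<rightarrow>\<^sub>E carrier N.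
     (\<forall>x\<in>carrier M. \<forall>y\<in>carrier M. f (x \<oplus>\<^bsub>M\<^esub> y) = f x \<oplus>\<^bsub>N\<^esub> f y) \<and>
     (\<forall>r\<in>carrier R. \<forall>x\<in>carrier M. f (r \<odot>\<^bsub>M\<^esub> x) = r \<odot>\<^bsub>N\<^esub> f x)}"

text \<open>
  A (not necessarily full) subcategory of the category of \<open>R\<close>-modules with underlying
  sets in \<open>'b\<close>, with objects \<open>Ob\<close> and morphisms \<open>Hom\<close>.
\<close>

locale module_category = cring R for R :: "('a, 'r) ring_scheme" (structure) +
  fixes Ob :: "('a, 'b) module set"
    and Hom :: "('a, 'b) module \<Rightarrow> ('a, 'b) module \<Rightarrow> ('b \<Rightarrow> 'b) set"
  assumes Ob_module: "M \<in> Ob \<Longrightarrow> module R M"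
    and Hom_linear: "\<lbrakk>M \<in> Ob; N \<in> Ob\<rbrakk> \<Longrightarrow> Hom M N \<subseteq> linear_maps R M N"
    and Hom_id: "M \<in> Ob \<Longrightarrow> (\<lambda>x\<in>carrier M. x) \<in> Hom M M"
    and Hom_compose: "\<lbrakk>M \<in> Ob; N \<in> Ob; K \<in> Ob; f \<in> Hom M N; g \<in> Hom N K\<rbrakk>
      \<Longrightarrow> compose (carrier M) g f \<in> Hom M K"

definition isomorphism ::
  "(('a, 'b) module \<Rightarrow> ('a, 'b) module \<Rightarrow> ('b \<Rightarrow> 'b) set)
    \<Rightarrow> ('a, 'b) module \<Rightarrow> ('a, 'b) module \<Rightarrow> ('b \<Rightarrow> 'b) \<Rightarrow> bool" where
  "isomorphism Hom M N \<phi> \<longleftrightarrow> \<phi> \<in> Hom M N \<and>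
     (\<exists>\<psi>\<in>Hom N M. compose (carrier M) \<psi> \<phi> = (\<lambda>x\<in>carrier M. x) \<and>
                  compose (carrier N) \<phi> \<psi> = (\<lambda>y\<in>carrier N. y))"

definition preenvelope ::
  "(('a, 'b) module \<Rightarrow> ('a, 'b) module \<Rightarrow> ('b \<Rightarrow> 'b) set) \<Rightarrow> ('a, 'b) module set
    \<Rightarrow> ('a, 'b) module \<Rightarrow> ('a, 'b) module \<Rightarrow> ('b \<Rightarrow> 'b) \<Rightarrow> bool" where
  "preenvelope Hom Cs M C \<alpha> \<longleftrightarrow> C \<in> Cs \<and> \<alpha> \<in> Hom M C \<and>
     (\<forall>D\<in>Cs. \<forall>g\<in>Hom M D. \<exists>h\<in>Hom C D. g = compose (carrier M) h \<alpha>)"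

definition preenveloping ::
  "('a, 'b) module set \<Rightarrow> (('a, 'b) module \<Rightarrow> ('a, 'b) module \<Rightarrow> ('b \<Rightarrow> 'b) set)
    \<Rightarrow> ('a, 'b) module set \<Rightarrow> bool" where
  "preenveloping Ob Hom Cs \<longleftrightarrow> Cs \<subseteq> Ob \<and> (\<forall>M\<in>Ob. \<exists>C \<alpha>. preenvelope Hom Cs M C \<alpha>)"

type_synonym ('a, 'b) pair_class = "('b set \<times> ('a, 'b) module) set"

type_synonym ('a, 'b) pair_op = "'b set \<Rightarrow> ('a, 'b) module \<Rightarrow> 'b set"

definition is_pair_class ::
  "('a, 'r) ring_scheme \<Rightarrow> ('a, 'b) module set
    \<Rightarrow> (('a, 'b) module \<Rightarrow> ('a, 'b) module \<Rightarrow> ('b \<Rightarrow> 'b) set)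
    \<Rightarrow> ('a, 'b) pair_class \<Rightarrow> bool" where
  "is_pair_class R Ob Hom P \<longleftrightarrow> (\<forall>(L, M)\<in>P. M \<in> Ob \<and> submodule L R M \<and>
     M\<lparr>carrier := L\<rparr> \<in> Ob \<and> (\<lambda>x\<in>L. x) \<in> Hom (M\<lparr>carrier := L\<rparr>) M)"

definition stable_under_morphisms ::
  "('a, 'b) module set \<Rightarrow> (('a, 'b) module \<Rightarrow> ('a, 'b) module \<Rightarrow> ('b \<Rightarrow> 'b) set)
    \<Rightarrow> ('a, 'b) pair_class \<Rightarrow> bool" where
  "stable_under_morphisms Ob Hom P \<longleftrightarrow>
     (\<forall>(L, M)\<in>P. \<forall>N\<in>Ob. \<forall>\<phi>\<in>Hom M N. (\<phi> ` L, N) \<in> P)"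

definition restrict_pairs ::
  "('a, 'b) pair_class \<Rightarrow> ('a, 'b) module set \<Rightarrow> ('a, 'b) pair_class" where
  "restrict_pairs P Cs = {(L, C). (L, C) \<in> P \<and> C \<in> Cs}"

text \<open>
  A pair operation on \<open>P\<close> is a total function of which only the values at pairs in \<open>P\<close>
  matter.  Accordingly, compatibility with an isomorphism is required when \<open>p\<close> is defined
  on both sides; this is automatic if \<open>P\<close> is stable under morphisms.
\<close>

definition pair_operation ::
  "('a, 'r) ring_scheme \<Rightarrow> (('a, 'b) module \<Rightarrow> ('a, 'b) module \<Rightarrow> ('b \<Rightarrow> 'b) set)
    \<Rightarrow> ('a, 'b) pair_class \<Rightarrow> ('a, 'b) pair_op \<Rightarrow> bool" where
  "pair_operation R Hom P p \<longleftrightarrow>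
     (\<forall>(L, M)\<in>P. submodule (p L M) R M) \<and>
     (\<forall>L M N \<phi>. (L, M) \<in> P \<longrightarrow> (\<phi> ` L, N) \<in> P \<longrightarrow> isomorphism Hom M N \<phi> \<longrightarrow>
        \<phi> ` p L M = p (\<phi> ` L) N)"

definition functorial_op ::
  "(('a, 'b) module \<Rightarrow> ('a, 'b) module \<Rightarrow> ('b \<Rightarrow> 'b) set)
    \<Rightarrow> ('a, 'b) pair_class \<Rightarrow> ('a, 'b) pair_op \<Rightarrow> bool" where
  "functorial_op Hom P p \<longleftrightarrow>
     (\<forall>L M N g. (L, M) \<in> P \<longrightarrow> (g ` L, N) \<in> P \<longrightarrow> g \<in> Hom M N \<longrightarrow>
        g ` p L M \<subseteq> p (g ` L) N)"

definition extensive_op :: "('a, 'b) pair_class \<Rightarrow> ('a, 'b) pair_op \<Rightarrow> bool" where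
  "extensive_op P p \<longleftrightarrow> (\<forall>(L, M)\<in>P. L \<subseteq> p L M)"

definition order_preserving_op ::
  "('a, 'b) pair_class \<Rightarrow> ('a, 'b) pair_op \<Rightarrow> bool" where
  "order_preserving_op P p \<longleftrightarrow>
     (\<forall>L N M. (L, M) \<in> P \<longrightarrow> (N, M) \<in> P \<longrightarrow> L \<subseteq> N \<longrightarrow> p L M \<subseteq> p N M)"

definition idempotent_op :: "('a, 'b) pair_class \<Rightarrow> ('a, 'b) pair_op \<Rightarrow> bool" where
  "idempotent_op P p \<longleftrightarrow>
     (\<forall>L M. (L, M) \<in> P \<longrightarrow> (p L M, M) \<in> P \<longrightarrow> p (p L M) M = p L M)"

definition closure_operation :: "('a, 'b) pair_class \<Rightarrow> ('a, 'b) pair_op \<Rightarrow> bool" where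
  "closure_operation P p \<longleftrightarrow>
     extensive_op P p \<and> order_preserving_op P p \<and> idempotent_op P p"

text \<open>
  \<open>\<alpha>\<^sup>-\<^sup>1(p(\<alpha>(L), C))\<close> for a map \<open>\<alpha>\<close> from \<open>M\<close> to \<open>C\<close>.
\<close>

definition pullback ::
  "('a, 'b) pair_op \<Rightarrow> 'b set \<Rightarrow> ('a, 'b) module \<Rightarrow> ('a, 'b) module \<Rightarrow> ('b \<Rightarrow> 'b) \<Rightarrow> 'b set" where
  "pullback p L M C \<alpha> = {x \<in> carrier M. \<alpha> x \<in> p (\<alpha> ` L) C}"

text \<open>
  The operation \<open>p\<^bsub>h(\<C>)\<^esub>\<close>: the common value of the pullbacks along all preenvelopes of
  \<open>M\<close>.  That there is exactly one such value is part of what has to be proved.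
\<close>

definition hull_op ::
  "(('a, 'b) module \<Rightarrow> ('a, 'b) module \<Rightarrow> ('b \<Rightarrow> 'b) set) \<Rightarrow> ('a, 'b) module set
    \<Rightarrow> ('a, 'b) pair_op \<Rightarrow> ('a, 'b) pair_op" where
  "hull_op Hom Cs p L M = (THE S. \<exists>C \<alpha>. preenvelope Hom Cs M C \<alpha> \<and> S = pullback p L M C \<alpha>)"

text \<open>
  The class contains \<open>(p(L,M), M)\<close> along with \<open>(L,M)\<close>, so that \<open>p\<close> can be iterated.
  Without this, idempotence of \<open>p\<close> may hold vacuously, and it does not pass to the hull
  operation.  Example: \<open>R = \<int>\<close>; objects \<open>0, 6\<int>, 2\<int>, \<int>\<close> with all inclusions as morphisms;
  \<open>\<C> = {\<int>}\<close>; pairs \<open>(0,M), (6\<int>,M)\<close> for \<open>M = 2\<int>, \<int>\<close>; \<open>p(0,\<int>) = 3\<int>\<close> and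
  \<open>p(6\<int>,\<int>) = \<int>\<close>.  The hull operation sends \<open>(0,2\<int>)\<close> to \<open>6\<int>\<close>, but \<open>(6\<int>,2\<int>)\<close> to \<open>2\<int>\<close>.
\<close>

definition closed_under_op :: "('a, 'b) pair_class \<Rightarrow> ('a, 'b) pair_op \<Rightarrow> bool" where
  "closed_under_op P p \<longleftrightarrow> (\<forall>(L, M)\<in>P. (p L M, M) \<in> P)"

end

theory Submission
  imports Defs
begin

text \<open>
  Every morphism from \<open>M\<close> into \<open>\<C>\<close> factors through a preenvelope \<open>\<alpha>\<close>, so functoriality of \<open>p\<close>
  identifies \<open>\<alpha>\<^sup>-\<^sup>1(p(\<alpha>(L), C))\<close> with the set of \<open>x\<close> such that \<open>g(x) \<in> p(g(L), D)\<close> for all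
  \<open>g: M \<rightarrow> D\<close> with \<open>D \<in> \<C>\<close>.  This description does not mention \<open>\<alpha>\<close>, and it is visibly functorial
  in \<open>M\<close>; compatibility with isomorphisms is functoriality applied in both directions.
\<close>

lemma submodule_linear_preimage:
  assumes M: "module R M" and N: "module R N" and f: "f \<in> linear_maps R M N"
    and K: "submodule K R N"
  shows "submodule {x \<in> carrier M. f x \<in> K} R M"
proof -
  interpret M: module R M by (rule M)
  interpret N: module R N by (rule N)
  have maps: "f x \<in> carrier N" if "x \<in> carrier M" for x
    using f that by (auto simp: linear_maps_def)
  have add: "f (x \<oplus>\<^bsub>M\<^esub> y) = f x \<oplus>\<^bsub>N\<^esub> f y" if "x \<in> carrier M" "y \<in> carrier M" for x y
    using f that by (auto simp: linear_maps_def)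
  have smult: "f (r \<odot>\<^bsub>M\<^esub> x) = r \<odot>\<^bsub>N\<^esub> f x" if "r \<in> carrier R" "x \<in> carrier M" for r x
    using f that by (auto simp: linear_maps_def)
  have "f (\<zero>\<^bsub>R\<^esub> \<odot>\<^bsub>M\<^esub> \<zero>\<^bsub>M\<^esub>) = \<zero>\<^bsub>R\<^esub> \<odot>\<^bsub>N\<^esub> f \<zero>\<^bsub>M\<^esub>"
    by (rule smult) auto
  hence zero: "f \<zero>\<^bsub>M\<^esub> = \<zero>\<^bsub>N\<^esub>"
    using maps[of "\<zero>\<^bsub>M\<^esub>"] by simp
  have neg: "f (\<ominus>\<^bsub>M\<^esub> x) = \<ominus>\<^bsub>N\<^esub> f x" if x: "x \<in> carrier M" for x
    using add[of "\<ominus>\<^bsub>M\<^esub> x" x] x maps zero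
    by (metis M.add.inv_closed M.l_neg N.add.inv_equality)
  have zero_in: "\<zero>\<^bsub>N\<^esub> \<in> K"
    using K subgroup.one_closed by (fastforce simp: submodule_def)
  show ?thesis
    by (rule M.submoduleI)
      (use N.submoduleE[OF K] N.l_zero smult add zero neg in
        \<open>auto simp: zero_in intro: submodule.smult_closed[OF K]\<close>)
qed

text \<open>The standing hypotheses. Order preservation, extensivity and the closure axioms stay
  outside, since each belongs only to particular conclusions.\<close>

locale hull_setting = module_category R Ob Hom
  for R :: "('a, 'r) ring_scheme" (structure)
    and Ob :: "('a, 'b) module set"
    and Hom :: "('a, 'b) module \<Rightarrow> ('a, 'b) module \<Rightarrow> ('b \<Rightarrow> 'b) set" +
  fixes Cs :: "('a, 'b) module set"
    and P' :: "('a, 'b) pair_class"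
    and p :: "('a, 'b) pair_op"
  assumes preenveloping: "preenveloping Ob Hom Cs"
    and is_pair_class: "is_pair_class R Ob Hom P'"
    and stable: "stable_under_morphisms Ob Hom P'"
    and pair_operation: "pair_operation R Hom (restrict_pairs P' Cs) p"
    and functorial: "functorial_op Hom (restrict_pairs P' Cs) p"
begin

abbreviation P :: "('a, 'b) pair_class" where "P \<equiv> restrict_pairs P' Cs"
abbreviation ph :: "('a, 'b) pair_op" where "ph \<equiv> hull_op Hom Cs p"

lemma Cs_Ob: "C \<in> Cs \<Longrightarrow> C \<in> Ob"
  using preenveloping by (auto simp: preenveloping_def)

lemma preenvelopeE:
  assumes "M \<in> Ob" obtains C \<alpha> where "preenvelope Hom Cs M C \<alpha>"
  using preenveloping assms by (auto simp: preenveloping_def)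

lemma pair_Ob: "(L, M) \<in> P' \<Longrightarrow> M \<in> Ob"
  using is_pair_class by (auto simp: is_pair_class_def)

lemma pair_subset: "(L, M) \<in> P' \<Longrightarrow> L \<subseteq> carrier M"
  using is_pair_class by (fastforce simp: is_pair_class_def submodule_def dest: subgroup.subset)

lemma image_pair: "\<lbrakk>(L, M) \<in> P'; N \<in> Ob; g \<in> Hom M N\<rbrakk> \<Longrightarrow> (g ` L, N) \<in> P'"
  using stable by (auto simp: stable_under_morphisms_def)

lemma image_pair_Cs: "\<lbrakk>(L, M) \<in> P'; C \<in> Cs; g \<in> Hom M C\<rbrakk> \<Longrightarrow> (g ` L, C) \<in> P"
  by (simp add: restrict_pairs_def image_pair Cs_Ob)

lemma Hom_carrier: "\<lbrakk>M \<in> Ob; N \<in> Ob; g \<in> Hom M N; x \<in> carrier M\<rbrakk> \<Longrightarrow> g x \<in> carrier N"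
  using Hom_linear by (fastforce simp: linear_maps_def)

text \<open>\<open>compose A h g\<close> is \<open>undefined\<close> off \<open>A\<close>, hence the
  side condition. For pairs it is supplied by \<open>pair_subset\<close>.\<close>

lemma compose_image: "L \<subseteq> A \<Longrightarrow> compose A h g ` L = h ` g ` L"
  by (force simp: compose_def image_image)

section \<open>Independence of the preenvelope\<close>

lemma pullback_iff:
  assumes LM: "(L, M) \<in> P'" and \<alpha>: "preenvelope Hom Cs M C \<alpha>"
  shows "x \<in> pullback p L M C \<alpha> \<longleftrightarrow>
    x \<in> carrier M \<and> (\<forall>D\<in>Cs. \<forall>g\<in>Hom M D. g x \<in> p (g ` L) D)"
proof (intro iffI conjI ballI)
  assume x: "x \<in> pullback p L M C \<alpha>"
  thus xM: "x \<in> carrier M" by (simp add: pullback_def)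
  fix D g assume D: "D \<in> Cs" and g: "g \<in> Hom M D"
  \<comment> \<open>Functoriality of \<open>p\<close> cannot be applied to \<open>g\<close>, as
    \<open>M\<close> may lie outside \<open>Cs\<close>. The factor \<open>h\<close> runs between
    members of \<open>Cs\<close>, where it can.\<close>
  obtain h where h: "h \<in> Hom C D" and gh: "g = compose (carrier M) h \<alpha>"
    using \<alpha> D g by (auto simp: preenvelope_def)
  have gL: "g ` L = h ` \<alpha> ` L"
    by (simp add: gh compose_image pair_subset[OF LM])
  have "(\<alpha> ` L, C) \<in> P" "(h ` \<alpha> ` L, D) \<in> P"
    using \<alpha> image_pair_Cs[OF LM D g] image_pair_Cs[OF LM] by (auto simp: preenvelope_def gL)
  hence "h ` p (\<alpha> ` L) C \<subseteq> p (h ` \<alpha> ` L) D"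
    using functorial h unfolding functorial_op_def by blast
  moreover have "g x = h (\<alpha> x)"
    using xM by (simp add: gh compose_eq)
  ultimately show "g x \<in> p (g ` L) D"
    using x by (auto simp: gL pullback_def)
next
  assume "x \<in> carrier M \<and> (\<forall>D\<in>Cs. \<forall>g\<in>Hom M D. g x \<in> p (g ` L) D)"
  \<comment> \<open>The preenvelope \<alpha> is itself one of the maps \<open>g\<close>.\<close>
  thus "x \<in> pullback p L M C \<alpha>"
    using \<alpha> by (auto simp: pullback_def preenvelope_def)
qed

lemma pullback_unique:
  assumes "(L, M) \<in> P'" "preenvelope Hom Cs M C \<alpha>" "preenvelope Hom Cs M D \<beta>"
  shows "pullback p L M C \<alpha> = pullback p L M D \<beta>"
  using assms by (auto simp: pullback_iff)

lemma ph_eq_pullback: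
  assumes "(L, M) \<in> P'" "preenvelope Hom Cs M C \<alpha>"
  shows "ph L M = pullback p L M C \<alpha>"
  unfolding hull_op_def 
  by (rule the_equality) (use assms pullback_unique in blast)+

lemma in_ph_iff:
  assumes "(L, M) \<in> P'"
  shows "x \<in> ph L M \<longleftrightarrow> x \<in> carrier M \<and> (\<forall>C\<in>Cs. \<forall>g\<in>Hom M C. g x \<in> p (g ` L) C)"
proof -
  obtain C \<alpha> where "preenvelope Hom Cs M C \<alpha>"
    using assms by (blast intro: pair_Ob preenvelopeE)
  thus ?thesis
    using assms by (simp add: ph_eq_pullback pullback_iff)
qed

lemma ex1_pullback:
  assumes "(L, M) \<in> P'"
  shows "\<exists>!S. \<exists>C \<alpha>. preenvelope Hom Cs M C \<alpha> \<and> S = pullback p L M C \<alpha>"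
  using assms by (metis pullback_unique preenvelopeE pair_Ob)

section \<open>The hull as a functorial pair operation\<close>

lemma submodule_ph:
  assumes LM: "(L, M) \<in> P'"
  shows "submodule (ph L M) R M"
proof -
  have M: "M \<in> Ob" using LM by (rule pair_Ob)
  \<comment> \<open>A single preenvelope is handier here than the criterion with all maps: it
    presents \<open>ph L M\<close> as the preimage of one submodule under one linear map.\<close>
  then obtain C \<alpha> where \<alpha>: "preenvelope Hom Cs M C \<alpha>" by (rule preenvelopeE)
  hence C: "C \<in> Cs" and \<alpha>H: "\<alpha> \<in> Hom M C" by (auto simp: preenvelope_def)
  have "submodule (p (\<alpha> ` L) C) R C"
    using pair_operation image_pair_Cs[OF LM C \<alpha>H] by (auto simp: pair_operation_def)
  thus ?thesis
    unfolding ph_eq_pullback[OF LM \<alpha>] pullback_def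
    using Hom_linear M C \<alpha>H by (blast intro: submodule_linear_preimage Ob_module Cs_Ob)
qed

lemma functorial_ph: "functorial_op Hom P' ph"
  unfolding functorial_op_def
proof (intro allI impI subsetI)
  fix L M N g y
  assume LM: "(L, M) \<in> P'" and gN: "(g ` L, N) \<in> P'" and g: "g \<in> Hom M N"
    and "y \<in> g ` ph L M"
  then obtain x where y: "y = g x" and x: "x \<in> ph L M" by blast
  have M: "M \<in> Ob" and N: "N \<in> Ob" using LM gN by (auto intro: pair_Ob)
  have xM: "x \<in> carrier M" using x LM by (simp add: in_ph_iff)
  \<comment> \<open>A test map \<open>h\<close> on \<open>N\<close> becomes the test map
    \<open>h\<close> after \<open>g\<close> on \<open>M\<close>, and \<open>x\<close> passes that
    test.\<close>
  have "h y \<in> p (h ` g ` L) C" if C: "C \<in> Cs" and h: "h \<in> Hom N C" for C h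
  proof -
    have "compose (carrier M) h g \<in> Hom M C"
      using M N C g h by (blast intro: Hom_compose Cs_Ob)
    hence "compose (carrier M) h g x \<in> p (compose (carrier M) h g ` L) C"
      using x LM C by (auto simp: in_ph_iff)
    thus ?thesis
      using xM by (simp add: y compose_image pair_subset[OF LM] compose_eq)
  qed
  thus "y \<in> ph (g ` L) N"
    using xM M N g y gN by (auto simp: in_ph_iff intro: Hom_carrier)
qed

lemma isomorphism_ph:
  assumes LM: "(L, M) \<in> P'" and N: "(\<phi> ` L, N) \<in> P'" and iso: "isomorphism Hom M N \<phi>"
  shows "\<phi> ` ph L M = ph (\<phi> ` L) N"
proof
  obtain \<psi> where \<psi>: "\<psi> \<in> Hom N M" and \<phi>: "\<phi> \<in> Hom M N"
    and \<psi>\<phi>: "compose (carrier M) \<psi> \<phi> = (\<lambda>x\<in>carrier M. x)"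
    and \<phi>\<psi>: "compose (carrier N) \<phi> \<psi> = (\<lambda>y\<in>carrier N. y)"
    using iso by (auto simp: isomorphism_def)
  show "\<phi> ` ph L M \<subseteq> ph (\<phi> ` L) N"
    using functorial_ph LM N \<phi> unfolding functorial_op_def by blast
  \<comment> \<open>Functoriality along \<psi> ends at the pair with first entry
    \<open>\<psi>\<close> \<phi> \<open>L\<close>; this must be recognized as \<open>L\<close>
    before the inclusion lands in \<open>ph L M\<close>.\<close>
  have "\<psi> ` \<phi> ` L = (\<lambda>x\<in>carrier M. x) ` L"
    using compose_image[OF pair_subset[OF LM]] \<psi>\<phi> by metis
  also have "\<dots> = L"
    using pair_subset[OF LM] by force
  finally have L: "\<psi> ` \<phi> ` L = L" .
  have sub: "\<psi> ` ph (\<phi> ` L) N \<subseteq> ph L M"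
    using functorial_ph LM N \<psi> L unfolding functorial_op_def by metis
  show "ph (\<phi> ` L) N \<subseteq> \<phi> ` ph L M"
  proof
    fix y assume y: "y \<in> ph (\<phi> ` L) N"
    hence "y \<in> carrier N" using N by (simp add: in_ph_iff)
    hence "\<phi> (\<psi> y) = y" using fun_cong[OF \<phi>\<psi>, of y] by (simp add: compose_eq)
    thus "y \<in> \<phi> ` ph L M" using sub y by (metis image_subset_iff imageI)
  qed
qed

lemma pair_operation_ph: "pair_operation R Hom P' ph"
  unfolding pair_operation_def by (auto simp: submodule_ph isomorphism_ph)

section \<open>Properties inherited from \<open>p\<close>\<close>

lemma order_preserving_ph:
  assumes "order_preserving_op P p"
  shows "order_preserving_op P' ph"
  unfolding order_preserving_op_def
proof (intro allI impI subsetI)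
  fix L N M x
  assume L: "(L, M) \<in> P'" and N: "(N, M) \<in> P'" and LN: "L \<subseteq> N" and x: "x \<in> ph L M"
  have "p (g ` L) C \<subseteq> p (g ` N) C" if "C \<in> Cs" "g \<in> Hom M C" for C g
    using assms image_pair_Cs[OF L that] image_pair_Cs[OF N that] image_mono[OF LN, of g]
    unfolding order_preserving_op_def by blast
  thus "x \<in> ph N M"
    using x unfolding in_ph_iff[OF L] in_ph_iff[OF N] by blast
qed

lemma extensive_ph:
  assumes "extensive_op P p"
  shows "extensive_op P' ph"
proof -
  have "x \<in> ph L M" if LM: "(L, M) \<in> P'" and x: "x \<in> L" for L M x
  proof -
    have "g x \<in> p (g ` L) C" if "C \<in> Cs" "g \<in> Hom M C" for C g
      using assms image_pair_Cs[OF LM that] x unfolding extensive_op_def by blast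
    thus ?thesis using x pair_subset[OF LM] by (auto simp: in_ph_iff[OF LM])
  qed
  thus ?thesis by (auto simp: extensive_op_def)
qed

lemma idempotent_ph:
  assumes cl: "closure_operation P p" and closed: "closed_under_op P p"
  shows "idempotent_op P' ph"
  unfolding idempotent_op_def
proof (intro allI impI subset_antisym subsetI)
  fix L M x
  assume LM: "(L, M) \<in> P'" and pM: "(ph L M, M) \<in> P'"
  \<comment> \<open>This inclusion is extensivity of \<open>ph\<close> at the pair
    \<open>(ph L M, M)\<close>.\<close>
  show "x \<in> ph (ph L M) M" if "x \<in> ph L M"
    using extensive_ph cl pM that by (auto simp: closure_operation_def extensive_op_def)
  show "x \<in> ph L M" if x: "x \<in> ph (ph L M) M"
  proof -
    have "g x \<in> p (g ` L) C" if C: "C \<in> Cs" and g: "g \<in> Hom M C" for C g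
    proof -
      have gL: "(g ` L, C) \<in> P" and gpL: "(g ` ph L M, C) \<in> P"
        using LM pM C g by (auto intro: image_pair_Cs)
      \<comment> \<open>Both order preservation and idempotence of \<open>p\<close> speak only about
        pairs in \<open>P\<close>, so the iterated pair has to be known to lie there.\<close>
      have pgL: "(p (g ` L) C, C) \<in> P"
        using closed gL by (auto simp: closed_under_op_def)
      have "g ` ph L M \<subseteq> p (g ` L) C"
        using LM C g by (auto simp: in_ph_iff)
      hence "p (g ` ph L M) C \<subseteq> p (p (g ` L) C) C"
        using cl gpL pgL by (auto simp: closure_operation_def order_preserving_op_def)
      also have "\<dots> = p (g ` L) C"
        using cl gL pgL by (auto simp: closure_operation_def idempotent_op_def)
      finally show ?thesis
        using x pM C g by (auto simp: in_ph_iff)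
    qed
    thus ?thesis using x LM pM by (auto simp: in_ph_iff)
  qed
qed

lemma closure_ph:
  assumes "closure_operation P p" "closed_under_op P p"
  shows "closure_operation P' ph"
  using assms order_preserving_ph extensive_ph idempotent_ph[OF assms]
  by (simp add: closure_operation_def)

end

theorem proposition8p9:
  fixes R :: "('a, 'r) ring_scheme"
    and Ob Cs :: "('a, 'b) module set"
    and Hom :: "('a, 'b) module \<Rightarrow> ('a, 'b) module \<Rightarrow> ('b \<Rightarrow> 'b) set"
    and P' :: "('a, 'b) pair_class"
    and p :: "('a, 'b) pair_op"
  defines "P \<equiv> restrict_pairs P' Cs"
    and "ph \<equiv> hull_op Hom Cs p"
  assumes "module_category R Ob Hom"
    and "preenveloping Ob Hom Cs"
    and "is_pair_class R Ob Hom P'"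
    and "stable_under_morphisms Ob Hom P'"
    and "pair_operation R Hom P p"
    and "functorial_op Hom P p"
  shows "(\<forall>(L, M)\<in>P'. \<exists>!S. \<exists>C \<alpha>. preenvelope Hom Cs M C \<alpha> \<and> S = pullback p L M C \<alpha>) \<and>
     (\<forall>(L, M)\<in>P'. \<forall>C \<alpha>. preenvelope Hom Cs M C \<alpha> \<longrightarrow> ph L M = pullback p L M C \<alpha>) \<and>
     pair_operation R Hom P' ph \<and>
     functorial_op Hom P' ph \<and>
     (order_preserving_op P p \<longrightarrow> order_preserving_op P' ph) \<and>
     (extensive_op P p \<longrightarrow> extensive_op P' ph) \<and>
     (closure_operation P p \<and> closed_under_op P p \<longrightarrow> idempotent_op P' ph) \<and>
     (\<forall>(L, M)\<in>P'. \<forall>x\<in>carrier M.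
        x \<in> ph L M \<longleftrightarrow> (\<forall>C\<in>Cs. \<forall>g\<in>Hom M C. g x \<in> p (g ` L) C)) \<and>
     (closure_operation P p \<and> closed_under_op P p \<longrightarrow> closure_operation P' ph)"
proof -
  interpret hull_setting R Ob Hom Cs P' p
    using assms(3-) unfolding P_def by (intro hull_setting.intro hull_setting_axioms.intro)
  show ?thesis
    unfolding P_def ph_def
  proof (intro conjI impI)
    show "\<forall>(L, M)\<in>P'. \<exists>!S. \<exists>C \<alpha>. preenvelope Hom Cs M C \<alpha> \<and> S = pullback p L M C \<alpha>"
      using ex1_pullback by blast
    show "\<forall>(L, M)\<in>P'. \<forall>C \<alpha>. preenvelope Hom Cs M C \<alpha> \<longrightarrow>
        hull_op Hom Cs p L M = pullback p L M C \<alpha>"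
      using ph_eq_pullback by blast
    show "\<forall>(L, M)\<in>P'. \<forall>x\<in>carrier M. x \<in> hull_op Hom Cs p L M \<longleftrightarrow>
        (\<forall>C\<in>Cs. \<forall>g\<in>Hom M C. g x \<in> p (g ` L) C)"
      using in_ph_iff by blast
  qed (simp_all add: pair_operation_ph functorial_ph order_preserving_ph extensive_ph
      idempotent_ph closure_ph)
qed

end
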